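(* Let $n\ge 1$ and $0\le k\le n-1$ be integers, and let $\sigma=s_1\cdots s_n\in S_n$ be a permutation. Then $$|\varphi_k^{-1}(\sigma)| = \prod_{i=1}^n \ell_k(i;\sigma).$$
   Context: Write $[n]=\{1,\dots,n\}$. A street has parking spots $1,\dots,n$ in order, and cars $c_1,\dots,c_n$ arrive in this order. A parking preference is a tuple $\alpha=(a_1,\dots,a_n)\in[n]^n$, where $a_i$ is the preferred spot of $c_i$. $k$-Naples parking rule: car $c_i$ drives to spot $a_i$; if it is empty, $c_i$ parks there. If it is occupied, $c_i$ backs up one spot at a time, checking spots $a_i-1,a_i-2,\dots$ in turn, up to at most $k$ spots behind $a_i$ (and never past spot $1$), and parks in the first empty one it finds. If all of these spots are occupied, $c_i$ goes forward and parks in the first empty spot after $a_i$, if there is one; otherwise it fails to park. The preference $\alpha$ is a $k$-Naples parking function of length $n$ if all $n$ cars park under this rule; $PF_{n,k}$ is the set of all of these. $S_n$ is the symmetric group on $[n]$, with permutations in one-line notation. The map $\varphi_k:PF_{n,k}\to S_n$ sends $\alpha$ to $s_1s_2\cdots s_n$, where spot $i$ is occupied by car $c_{s_i}$ after all cars have parked under the $k$-Naples rule. $\varphi_k^{-1}(\sigma)\subseteq PF_{n,k}$ denotes the fiber. For $\sigma=s_1\cdots s_n\in S_n$ and $1\le i\le n$ (subsequences here are blocks of consecutive entries): - $\mathtt{left}_k(i;\sigma)$ is the length of the longest subsequence $s_j\cdots s_{i-1}$ such that $s_t<s_i$ for all $j\le t<i$ (equal to $0$ if it is empty). - $\mathtt{right}_k(i;\sigma)$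 is the length of the longest subsequence $s_i\cdots s_r$ such that $r\le i+k$ (and $r\le n$) and $s_t\le s_i$ for all $i\le t\le r$. - $\ell_k(i;\sigma)=\mathtt{left}_k(i;\sigma)+\mathtt{right}_k(i;\sigma)$ if $\mathtt{left}_k(i;\sigma)=i-1$, and $\ell_k(i;\sigma)=\max(\mathtt{left}_k(i;\sigma)-k,0)+\mathtt{right}_k(i;\sigma)$ if $\mathtt{left}_k(i;\sigma)<i-1$. *)

theory Defs
  imports "HOL-Library.FuncSet" "HOL-Combinatorics.Permutations"
begin

text \<open>
  Cars and spots are numbered from 1. A preference is an element of
  \<open>{1..n} \<rightarrow>\<^sub>E {1..n}\<close> (the library's extensional functions, so that preferences can be
  counted), and a permutation \<open>s\<^sub>1\<dots>s\<^sub>n\<close> is a function \<open>\<sigma>\<close> with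
  \<open>\<sigma> permutes {1..n}\<close> and \<open>\<sigma> i = s\<^sub>i\<close>.
\<close>

text \<open>
  The list consists of the spots examined by a car with preference \<open>a\<close>, in the order in which they
  are examined: the preferred spot, then \<open>a - 1, a - 2, \<dots>, max 1 (a - k)\<close>, then
  \<open>a + 1, \<dots>, n\<close>. The result is \<open>None\<close> if the car fails to park.
\<close>
definition naples_spot :: "nat \<Rightarrow> nat \<Rightarrow> nat set \<Rightarrow> nat \<Rightarrow> nat option" where
  "naples_spot n k occupied a =
     find (\<lambda>s. s \<notin> occupied) ([a] @ rev [max 1 (a - k)..<a] @ [a + 1..<n + 1])"

text \<open>
  The street after the first \<open>i\<close> cars have arrived, as a partial map from spots to cars. A car that
  fails to park leaves it unchanged.
\<close>
primrec street :: "nat \<Rightarrow> nat \<Rightarrow> (nat \<Rightarrow> nat) \<Rightarrow> nat \<Rightarrow> (nat \<rightharpoonup> nat)" where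
  "street n k \<alpha> 0 = Map.empty"
| "street n k \<alpha> (Suc i) =
     (case naples_spot n k (dom (street n k \<alpha> i)) (\<alpha> (Suc i)) of
        None \<Rightarrow> street n k \<alpha> i
      | Some s \<Rightarrow> (street n k \<alpha> i)(s \<mapsto> Suc i))"

definition naples_parking_functions :: "nat \<Rightarrow> nat \<Rightarrow> (nat \<Rightarrow> nat) set" where
  "naples_parking_functions n k =
     {\<alpha> \<in> {1..n} \<rightarrow>\<^sub>E {1..n}. \<forall>c\<in>{1..n}. c \<in> ran (street n k \<alpha> n)}"

text \<open>
  Extended by the identity outside \<open>{1..n}\<close>, to agree with the convention of \<open>permutes\<close>.
\<close>
definition outcome :: "nat \<Rightarrow> nat \<Rightarrow> (nat \<Rightarrow> nat) \<Rightarrow> (nat \<Rightarrow> nat)" where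
  "outcome n k \<alpha> = (\<lambda>i. if i \<in> {1..n} then the (street n k \<alpha> n i) else i)"

text \<open>
  The index \<open>j = i\<close> stands for the empty block. The value does not depend on \<open>k\<close>, so \<open>k\<close> is not a
  parameter.
\<close>
definition left_len :: "(nat \<Rightarrow> nat) \<Rightarrow> nat \<Rightarrow> nat" where
  "left_len \<sigma> i = Max {i - j | j. 1 \<le> j \<and> j \<le> i \<and> (\<forall>t. j \<le> t \<and> t < i \<longrightarrow> \<sigma> t < \<sigma> i)}"

definition right_len :: "nat \<Rightarrow> nat \<Rightarrow> (nat \<Rightarrow> nat) \<Rightarrow> nat \<Rightarrow> nat" where
  "right_len n k \<sigma> i =
     Max {r - i + 1 | r. i \<le> r \<and> r \<le> i + k \<and> r \<le> n \<and> (\<forall>t. i \<le> t \<and> t \<le> r \<longrightarrow> \<sigma> t \<le> \<sigma> i)}"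

text \<open>
  Subtraction on \<^typ>\<open>nat\<close> truncates, so \<open>left_len \<sigma> i - k\<close> is the maximum of the
  integer difference and 0. The second case is \<open>left_len \<sigma> i < i - 1\<close>, since
  \<open>left_len \<sigma> i \<le> i - 1\<close> for \<open>i \<ge> 1\<close>.
\<close>
definition naples_len :: "nat \<Rightarrow> nat \<Rightarrow> (nat \<Rightarrow> nat) \<Rightarrow> nat \<Rightarrow> nat" where
  "naples_len n k \<sigma> i =
     (if left_len \<sigma> i = i - 1 then left_len \<sigma> i + right_len n k \<sigma> i
      else (left_len \<sigma> i - k) + right_len n k \<sigma> i)"

end

theory Submission
  imports Defs
begin

text \<open>
  Fix the outcome \<open>\<sigma>\<close>. When the car parking at spot \<open>i\<close> arrives, the occupied spots are exactly those
  \<open>t\<close> with \<open>\<sigma> t < \<sigma> i\<close>, whatever the preferences of the earlier cars were. So the preference of each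
  car can be chosen independently, and the fiber is a product of the sets of preferences leading to
  spot \<open>i\<close>. A preference \<open>a \<ge> i\<close> leads there iff the car backs up over a block of smaller entries of
  length at most \<open>k\<close>, which gives \<open>right_len\<close> choices. A preference \<open>a < i\<close> leads there iff \<open>a\<close> lies in
  the block counted by \<open>left_len\<close> and either the block reaches spot 1 or the free spot in front of
  the block is more than \<open>k\<close> spots behind \<open>a\<close>.
\<close>

section \<open>The parking rule as a search for a free spot\<close>

lemma find_append:
  "find P (xs @ ys) = (case find P xs of None \<Rightarrow> find P ys | Some x \<Rightarrow> Some x)"
  by (induction xs) auto

lemma find_upt_eq_Some_iff:
  "find P [p..<q] = Some s \<longleftrightarrow> p \<le> s \<and> s < q \<and> P s \<and> (\<forall>t. p \<le> t \<and> t < s \<longrightarrow> \<not> P t)"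
proof (induction q arbitrary: s)
  case (Suc q)
  show ?case
  proof (cases "find P [p..<q]")
    case None
    then have "\<forall>t. p \<le> t \<and> t < q \<longrightarrow> \<not> P t"
      by (auto simp: find_None_iff)
    then show ?thesis
      using None by (auto simp: find_append less_Suc_eq)
  next
    case (Some u)
    then have "p \<le> u" "u < q" "P u" "\<forall>t. p \<le> t \<and> t < u \<longrightarrow> \<not> P t"
      using Suc.IH by blast+
    \<comment> \<open>The first hit \<open>u\<close> is unique and lies below \<open>q\<close>, so
      appending \<open>q\<close> to the list cannot change the answer.\<close>
    moreover from this have "(p \<le> s \<and> s < Suc q \<and> P s \<and> (\<forall>t. p \<le> t \<and> t < s \<longrightarrow> \<not> P t)) \<longleftrightarrow> u = s"
      by (metis less_SucI linorder_neqE_nat)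
    ultimately show ?thesis
      using Some by (auto simp: find_append)
  qed
qed simp

lemma find_rev_upt_eq_Some_iff:
  "find P (rev [p..<q]) = Some s \<longleftrightarrow> p \<le> s \<and> s < q \<and> P s \<and> (\<forall>t. s < t \<and> t < q \<longrightarrow> \<not> P t)"
  by (induction q) (auto simp: less_Suc_eq)

text \<open>The backward scan finds the largest free spot within reach and the forward scan the
  smallest one ahead. A car that ends up ahead has first seen its whole backward reach occupied, so
  the spots it rejected fill one interval ending just before \<open>s\<close>.\<close>

lemma naples_spot_eq_Some_iff:
  assumes "1 \<le> a"
  shows "naples_spot n k B a = Some s \<longleftrightarrow> s \<notin> B \<and>
    (s \<le> a \<and> max 1 (a - k) \<le> s \<and> {s<..a} \<subseteq> B \<or> a < s \<and> s \<le> n \<and> {max 1 (a - k)..<s} \<subseteq> B)"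
proof (cases "a \<in> B")
  case False
  then have "naples_spot n k B a = Some a"
    by (simp add: naples_spot_def)
  moreover have "{s<..a} \<subseteq> B \<Longrightarrow> s \<le> a \<Longrightarrow> s = a"
    using False by (metis greaterThanAtMost_iff le_neq_implies_less order_refl subsetD)
  moreover have "{max 1 (a - k)..<s} \<subseteq> B \<Longrightarrow> \<not> a < s"
    using False assms by (auto simp: subset_iff)
  ultimately show ?thesis
    using False assms by auto
next
  case True
  let ?P = "\<lambda>s. s \<notin> B" and ?m = "max 1 (a - k)"
  have eq: "naples_spot n k B a =
      (case find ?P (rev [?m..<a]) of None \<Rightarrow> find ?P [a + 1..<n + 1] | Some x \<Rightarrow> Some x)"
    using True unfolding naples_spot_def by (simp only: find_append find.simps append.simps if_not_P) simp
  show ?thesis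
  proof (cases "find ?P (rev [?m..<a])")
    case None
    then have "{?m..<a} \<subseteq> B"
      by (auto simp: find_None_iff)
    moreover have "{?m..a} \<subseteq> insert a {?m..<a}"
      by auto
    ultimately have behind: "{?m..a} \<subseteq> B"
      using True by blast
    have "naples_spot n k B a = Some s \<longleftrightarrow> a < s \<and> s \<le> n \<and> s \<notin> B \<and> {a<..<s} \<subseteq> B"
      unfolding eq None option.case(1) find_upt_eq_Some_iff by (auto simp: subset_iff)
    also have "\<dots> \<longleftrightarrow> a < s \<and> s \<le> n \<and> s \<notin> B \<and> {?m..<s} \<subseteq> B"
    proof (cases "a < s")
      case True
      have "{?m..<s} = {?m..a} \<union> {a<..<s}"
        using True assms by auto
      then show ?thesis
        using behind by auto
    qed simp
    \<comment> \<open>The added disjunct is vacuous: every spot from \<open>?m\<close> to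
      \<open>a\<close> is occupied, while \<open>s\<close> is free.\<close>
    also have "\<dots> \<longleftrightarrow> s \<notin> B \<and>
        (s \<le> a \<and> ?m \<le> s \<and> {s<..a} \<subseteq> B \<or> a < s \<and> s \<le> n \<and> {?m..<s} \<subseteq> B)"
      using behind by (auto simp: subset_iff)
    finally show ?thesis .
  next
    case (Some u)
    then have u: "?m \<le> u" "u < a" "u \<notin> B" "\<forall>t. u < t \<and> t < a \<longrightarrow> t \<in> B"
      unfolding find_rev_upt_eq_Some_iff by auto
    have "naples_spot n k B a = Some s \<longleftrightarrow> s = u"
      using eq Some by auto
    also have "\<dots> \<longleftrightarrow> s \<notin> B \<and>
        (s \<le> a \<and> ?m \<le> s \<and> {s<..a} \<subseteq> B \<or> a < s \<and> s \<le> n \<and> {?m..<s} \<subseteq> B)"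
    proof
      assume "s = u"
      moreover have "{u<..a} \<subseteq> B"
        using u True by (metis greaterThanAtMost_iff nat_less_le subsetI)
      ultimately show "s \<notin> B \<and>
          (s \<le> a \<and> ?m \<le> s \<and> {s<..a} \<subseteq> B \<or> a < s \<and> s \<le> n \<and> {?m..<s} \<subseteq> B)"
        using u by auto
    next
      assume s: "s \<notin> B \<and>
          (s \<le> a \<and> ?m \<le> s \<and> {s<..a} \<subseteq> B \<or> a < s \<and> s \<le> n \<and> {?m..<s} \<subseteq> B)"
      \<comment> \<open>The free spot \<open>u\<close> within reach rules out going forward. Then
        \<open>s\<close> and \<open>u\<close> are both free with only occupied spots between each of
        them and \<open>a\<close>, so neither can be below the other.\<close>
      have "\<not> a < s"
      proof
        assume "a < s"
        then have "u \<in> {?m..<s}" "{?m..<s} \<subseteq> B"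
          using s u by auto
        then show False
          using u by blast
      qed
      with s have "s \<le> a" "{s<..a} \<subseteq> B" "s \<noteq> a"
        using True by auto
      moreover from this have "\<not> s < u"
        using u by (metis greaterThanAtMost_iff less_imp_le subsetD)
      ultimately have "s < a" "\<not> s < u"
        by simp_all
      then show "s = u"
        using s u by (meson linorder_neqE_nat)
    qed
    finally show ?thesis .
  qed
qed

lemma naples_spot_notin: "naples_spot n k B a = Some s \<Longrightarrow> s \<notin> B"
  unfolding naples_spot_def find_Some_iff by blast

lemma naples_spot_in_range:
  assumes "a \<in> {1..n}" "naples_spot n k B a = Some s"
  shows "s \<in> {1..n}"
  using assms by (auto simp: naples_spot_eq_Some_iff)

section \<open>The street over time and its final state\<close>

lemma street_SomeD:
  assumes "\<alpha> \<in> {1..n} \<rightarrow> {1..n}" "m \<le> n" "street n k \<alpha> m s = Some c"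
  shows "s \<in> {1..n}" "c \<in> {1..m}"
proof -
  have "s \<in> {1..n} \<and> c \<in> {1..m}"
    using assms(2,3)
  proof (induction m)
    case (Suc m)
    show ?case
    proof (cases "naples_spot n k (dom (street n k \<alpha> m)) (\<alpha> (Suc m)) = Some s")
      case True
      then have "c = Suc m"
        using Suc.prems(2) by simp
      moreover have "\<alpha> (Suc m) \<in> {1..n}"
        using assms(1) Suc.prems(1) by (auto simp: Pi_iff)
      ultimately show ?thesis
        using naples_spot_in_range[OF _ True] by simp
    next
      case False
      then have "street n k \<alpha> m s = Some c"
        using Suc.prems(2) by (auto split: option.splits if_splits)
      then show ?thesis
        using Suc.IH Suc.prems(1) by simp
    qed
  qed simp
  then show "s \<in> {1..n}" "c \<in> {1..m}"
    by auto
qed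

text \<open>Cars take only free spots, so no entry is ever overwritten. Hence the final street
  determines all earlier ones through the numbers of the parked cars.\<close>

lemma street_eq_Some_iff:
  assumes "\<alpha> \<in> {1..n} \<rightarrow> {1..n}" "m \<le> m'" "m' \<le> n"
  shows "street n k \<alpha> m s = Some c \<longleftrightarrow> street n k \<alpha> m' s = Some c \<and> c \<le> m"
  using assms(2,3)
proof (induction m' rule: dec_induct)
  case base
  then show ?case
    using street_SomeD(2)[OF assms(1), of m k s c] by auto
next
  case (step m')
  \<comment> \<open>The step writes only the label \<open>Suc m'\<close>, which exceeds
    \<open>c\<close>, and only on a free spot, so it neither creates nor destroys an entry
    \<open>c\<close>.\<close>
  have "street n k \<alpha> m' s = Some c \<longleftrightarrow> street n k \<alpha> (Suc m') s = Some c" if "c \<le> m"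
    using that step.hyps
    by (auto split: option.splits dest: naples_spot_notin)
  with step show ?case
    by auto
qed

text \<open>This decouples the cars. In one direction the occupied sets are read off the final
  street; in the other the street is rebuilt car by car.\<close>

lemma parking_outcome_iff:
  assumes \<alpha>: "\<alpha> \<in> {1..n} \<rightarrow>\<^sub>E {1..n}" and \<sigma>: "\<sigma> permutes {1..n}"
  shows "\<alpha> \<in> naples_parking_functions n k \<and> outcome n k \<alpha> = \<sigma> \<longleftrightarrow>
    (\<forall>i\<in>{1..n}. naples_spot n k {t \<in> {1..n}. \<sigma> t < \<sigma> i} (\<alpha> (\<sigma> i)) = Some i)"
proof
  have \<alpha>': "\<alpha> \<in> {1..n} \<rightarrow> {1..n}"
    using \<alpha> by (auto simp: PiE_def)
  assume "\<alpha> \<in> naples_parking_functions n k \<and> outcome n k \<alpha> = \<sigma>"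
  then have pf: "\<And>c. c \<in> {1..n} \<Longrightarrow> c \<in> ran (street n k \<alpha> n)" and out: "outcome n k \<alpha> = \<sigma>"
    by (auto simp: naples_parking_functions_def)
  \<comment> \<open>Since \<open>outcome\<close> uses \<open>the\<close>, its value alone does not
    show that a spot is filled. Instead the spot \<open>j\<close> of car \<open>\<sigma> i\<close>
    is located first, and injectivity of \<sigma> forces \<open>j = i\<close>.\<close>
  have full: "street n k \<alpha> n i = Some (\<sigma> i)" if i: "i \<in> {1..n}" for i
  proof -
    have "\<sigma> i \<in> {1..n}"
      using permutes_in_image[OF \<sigma>] i by blast
    then obtain j where j: "street n k \<alpha> n j = Some (\<sigma> i)"
      using pf by (auto simp: ran_def)
    then have "j \<in> {1..n}"
      using street_SomeD(1)[OF \<alpha>'] by blast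
    then have "\<sigma> j = \<sigma> i"
      using j out by (metis (no_types, lifting) option.sel outcome_def)
    then have "j = i"
      using permutes_inj[OF \<sigma>] by (auto dest: injD)
    with j show ?thesis
      by simp
  qed
  show "\<forall>i\<in>{1..n}. naples_spot n k {t \<in> {1..n}. \<sigma> t < \<sigma> i} (\<alpha> (\<sigma> i)) = Some i"
  proof
    fix i assume i: "i \<in> {1..n}"
    then have "\<sigma> i \<in> {1..n}"
      using permutes_in_image[OF \<sigma>] by blast
    then obtain c where c: "\<sigma> i = Suc c" "Suc c \<le> n"
      by (cases "\<sigma> i") auto
    have st: "street n k \<alpha> m t = Some d \<longleftrightarrow> t \<in> {1..n} \<and> \<sigma> t = d \<and> d \<le> m" if "m \<le> n" for m t d
      using street_eq_Some_iff[OF \<alpha>' that order.refl] full street_SomeD(1)[OF \<alpha>' order.refl]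
      by (metis option.inject)
    have "dom (street n k \<alpha> c) = {t \<in> {1..n}. \<sigma> t < \<sigma> i}"
      using c st[of c] by (auto simp: dom_def)
    \<comment> \<open>Spot \<open>i\<close> receives \<open>Suc c\<close> exactly in this step, so
      the search of that car must have returned \<open>i\<close>.\<close>
    moreover have "street n k \<alpha> c i \<noteq> Some (Suc c)" "street n k \<alpha> (Suc c) i = Some (Suc c)"
      using c i st[of c i] st[of "Suc c" i] by auto
    ultimately show "naples_spot n k {t \<in> {1..n}. \<sigma> t < \<sigma> i} (\<alpha> (\<sigma> i)) = Some i"
      using c by (auto split: option.splits if_splits)
  qed
next
  assume spot: "\<forall>i\<in>{1..n}. naples_spot n k {t \<in> {1..n}. \<sigma> t < \<sigma> i} (\<alpha> (\<sigma> i)) = Some i"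
  have "street n k \<alpha> c = (\<lambda>t. if t \<in> {1..n} \<and> \<sigma> t \<le> c then Some (\<sigma> t) else None)" if "c \<le> n" for c
    using that
  proof (induction c)
    case 0
    have "\<sigma> t \<noteq> 0" if "t \<in> {1..n}" for t
      using permutes_in_image[OF \<sigma>, of t] that by auto
    then show ?case
      by auto
  next
    case (Suc c)
    obtain i where i: "i \<in> {1..n}" "\<sigma> i = Suc c"
      using permutes_image[OF \<sigma>] Suc.prems by (metis Suc_le_eq atLeastAtMost_iff imageE le_add1 plus_1_eq_Suc)
    have "dom (street n k \<alpha> c) = {t \<in> {1..n}. \<sigma> t < \<sigma> i}"
      using Suc i by (auto simp: dom_def)
    then have "naples_spot n k (dom (street n k \<alpha> c)) (\<alpha> (Suc c)) = Some i"
      using spot i by metis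
    then have step: "street n k \<alpha> (Suc c) = (street n k \<alpha> c)(i \<mapsto> Suc c)"
      by simp
    \<comment> \<open>Raising the threshold from \<open>c\<close> to \<open>Suc c\<close> therefore
      adds the spot \<open>i\<close> and no other.\<close>
    have "\<sigma> t \<noteq> Suc c" if "t \<noteq> i" for t
      using that i(2) permutes_inj[OF \<sigma>] by (metis injD)
    then show ?case
      unfolding step using Suc.IH Suc.prems i by (auto simp: fun_eq_iff le_Suc_eq)
  qed
  then have street: "street n k \<alpha> n t = (if t \<in> {1..n} then Some (\<sigma> t) else None)" for t
    using permutes_in_image[OF \<sigma>] by auto
  have "c \<in> ran (street n k \<alpha> n)" if "c \<in> {1..n}" for c
  proof -
    have "c \<in> \<sigma> ` {1..n}"
      using permutes_image[OF \<sigma>] that by simp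
    then show ?thesis
      using street by (auto simp: ran_def)
  qed
  moreover have "outcome n k \<alpha> = \<sigma>"
    using permutes_not_in[OF \<sigma>] by (auto simp: outcome_def street fun_eq_iff)
  ultimately show "\<alpha> \<in> naples_parking_functions n k \<and> outcome n k \<alpha> = \<sigma>"
    using \<alpha> by (auto simp: naples_parking_functions_def)
qed

section \<open>Block lengths and the number of preferences leading to one spot\<close>

lemma
  assumes "1 \<le> i"
  shows left_len_le: "left_len \<sigma> i \<le> i - 1"
    and left_len_less: "\<And>t. i - left_len \<sigma> i \<le> t \<Longrightarrow> t < i \<Longrightarrow> \<sigma> t < \<sigma> i"
    and left_len_maximal: "\<And>j. 1 \<le> j \<Longrightarrow> j \<le> i \<Longrightarrow> (\<forall>t. j \<le> t \<and> t < i \<longrightarrow> \<sigma> t < \<sigma> i) \<Longrightarrow>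
      i - left_len \<sigma> i \<le> j"
proof -
  let ?A = "{i - j | j. 1 \<le> j \<and> j \<le> i \<and> (\<forall>t. j \<le> t \<and> t < i \<longrightarrow> \<sigma> t < \<sigma> i)}"
  have fin: "finite ?A"
    by simp
  \<comment> \<open>The empty block makes the set nonempty, so \<open>Max\<close> is
    attained.\<close>
  have "i - i \<in> ?A"
    using assms by fastforce
  then have "left_len \<sigma> i \<in> ?A"
    unfolding left_len_def using fin by (intro Max_in) auto
  then obtain j where j: "left_len \<sigma> i = i - j" "1 \<le> j" "j \<le> i"
      "\<forall>t. j \<le> t \<and> t < i \<longrightarrow> \<sigma> t < \<sigma> i"
    by auto
  then have j': "i - left_len \<sigma> i = j"
    by simp
  show "left_len \<sigma> i \<le> i - 1"
    using j by simp
  show "\<And>t. i - left_len \<sigma> i \<le> t \<Longrightarrow> t < i \<Longrightarrow> \<sigma> t < \<sigma> i"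
    using j j' by simp
  fix j assume "1 \<le> j" "j \<le> i" "\<forall>t. j \<le> t \<and> t < i \<longrightarrow> \<sigma> t < \<sigma> i"
  then have "i - j \<le> left_len \<sigma> i"
    unfolding left_len_def using fin by (intro Max_ge) auto
  then show "i - left_len \<sigma> i \<le> j"
    by simp
qed

text \<open>Shortening a valid block from the right keeps it valid, so the valid ends form an
  interval starting at \<open>i\<close>, with exclusive bound
  \<open>i + right_len n k \<sigma> i\<close>.\<close>

lemma right_len_iff:
  assumes "i \<le> n" "i \<le> r"
  shows "r < i + right_len n k \<sigma> i \<longleftrightarrow>
    r \<le> i + k \<and> r \<le> n \<and> (\<forall>t. i \<le> t \<and> t \<le> r \<longrightarrow> \<sigma> t \<le> \<sigma> i)"
proof -
  let ?A = "{r - i + 1 | r. i \<le> r \<and> r \<le> i + k \<and> r \<le> n \<and> (\<forall>t. i \<le> t \<and> t \<le> r \<longrightarrow> \<sigma> t \<le> \<sigma> i)}"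
  have fin: "finite ?A"
    by simp
  have "i - i + 1 \<in> ?A"
    using assms by fastforce
  then have "right_len n k \<sigma> i \<in> ?A"
    unfolding right_len_def using fin by (intro Max_in) auto
  then obtain q where q: "right_len n k \<sigma> i = q - i + 1" "i \<le> q" "q \<le> i + k" "q \<le> n"
      "\<forall>t. i \<le> t \<and> t \<le> q \<longrightarrow> \<sigma> t \<le> \<sigma> i"
    by auto
  show ?thesis
  proof
    assume "r < i + right_len n k \<sigma> i"
    then have "r \<le> q"
      using q by simp
    then show "r \<le> i + k \<and> r \<le> n \<and> (\<forall>t. i \<le> t \<and> t \<le> r \<longrightarrow> \<sigma> t \<le> \<sigma> i)"
      using q by auto
  next
    assume "r \<le> i + k \<and> r \<le> n \<and> (\<forall>t. i \<le> t \<and> t \<le> r \<longrightarrow> \<sigma> t \<le> \<sigma> i)"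
    then have "r - i + 1 \<le> right_len n k \<sigma> i"
      unfolding right_len_def using fin assms by (intro Max_ge) auto
    then show "r < i + right_len n k \<sigma> i"
      by simp
  qed
qed

lemma card_preferences_for_spot:
  assumes \<sigma>: "inj \<sigma>" and i: "i \<in> {1..n}"
  shows "card {a \<in> {1..n}. naples_spot n k {t \<in> {1..n}. \<sigma> t < \<sigma> i} a = Some i} = naples_len n k \<sigma> i"
proof -
  let ?B = "{t \<in> {1..n}. \<sigma> t < \<sigma> i}" and ?l = "left_len \<sigma> i" and ?r = "right_len n k \<sigma> i"
  have i1: "1 \<le> i" "i \<le> n"
    using i by auto
  \<comment> \<open>\<open>R\<close> holds the preferences from which the car stays at
    \<open>i\<close> or backs up to it, \<open>L\<close> those from which it moves forward.\<close>
  define R where "R = {a \<in> {1..n}. i \<le> a \<and> a - k \<le> i \<and> {i<..a} \<subseteq> ?B}"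
  define L where "L = {a \<in> {1..n}. a < i \<and> {max 1 (a - k)..<i} \<subseteq> ?B}"
  have split: "{a \<in> {1..n}. naples_spot n k ?B a = Some i} = L \<union> R"
  proof (rule set_eqI)
    fix a
    have "naples_spot n k ?B a = Some i \<longleftrightarrow>
        (i \<le> a \<and> a - k \<le> i \<and> {i<..a} \<subseteq> ?B \<or> a < i \<and> {max 1 (a - k)..<i} \<subseteq> ?B)"
      if "a \<in> {1..n}"
      using that i1 by (subst naples_spot_eq_Some_iff) simp_all
    then show "a \<in> {a \<in> {1..n}. naples_spot n k ?B a = Some i} \<longleftrightarrow> a \<in> L \<union> R"
      unfolding L_def R_def by blast
  qed
  have R: "R = {i..<i + ?r}"
  proof (rule set_eqI)
    fix a
    \<comment> \<open>Injectivity reconciles the non-strict comparison in \<open>right_len\<close>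
      with the strict one defining the occupied spots.\<close>
    have le: "\<sigma> t \<le> \<sigma> i \<longleftrightarrow> t = i \<or> \<sigma> t < \<sigma> i" for t
      using \<sigma> by (auto simp: le_less dest: injD)
    have "a \<in> R \<longleftrightarrow> i \<le> a \<and> a \<le> i + k \<and> a \<le> n \<and> (\<forall>t. i \<le> t \<and> t \<le> a \<longrightarrow> \<sigma> t \<le> \<sigma> i)"
      unfolding R_def le using i1 by (auto simp: subset_iff nat_less_le)
    then show "a \<in> R \<longleftrightarrow> a \<in> {i..<i + ?r}"
      using right_len_iff[OF i1(2)] by auto
  qed
  have L_iff: "a \<in> L \<longleftrightarrow> 1 \<le> a \<and> a < i \<and> i - ?l \<le> max 1 (a - k)" for a
  proof
    assume a: "a \<in> L"
    then show "1 \<le> a \<and> a < i \<and> i - ?l \<le> max 1 (a - k)"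
      unfolding L_def using left_len_maximal[OF i1(1), of "max 1 (a - k)" \<sigma>]
      by (auto simp: subset_iff)
  next
    assume "1 \<le> a \<and> a < i \<and> i - ?l \<le> max 1 (a - k)"
    then show "a \<in> L"
      unfolding L_def using left_len_less[OF i1(1), of \<sigma>] i1 by auto
  qed
  have "card L = (if ?l = i - 1 then ?l else ?l - k)"
  proof (cases "?l = i - 1")
    case True
    \<comment> \<open>The block starts at spot 1, so backing up can never leave it.\<close>
    then have "i - ?l \<le> max 1 (a - k)" for a
      by linarith
    then have "L = {1..<i}"
      unfolding set_eq_iff L_iff by simp
    with True show ?thesis
      by simp
  next
    case False
    then have "1 < i - ?l"
      using left_len_le[OF i1(1), of \<sigma>] by linarith
    \<comment> \<open>The block starts beyond spot 1, so the bound must be met by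
      \<open>a - k\<close> and not by the 1 in the maximum.\<close>
    then have "1 \<le> a \<and> a < i \<and> i - ?l \<le> max 1 (a - k) \<longleftrightarrow> i - ?l + k \<le> a \<and> a < i" for a
      by linarith
    then have "L = {i - ?l + k..<i}"
      unfolding set_eq_iff L_iff by simp
    \<comment> \<open>For \<open>k \<ge> ?l\<close> the interval is empty, in agreement with the
      truncated difference \<open>?l - k\<close>.\<close>
    then have "card L = i - (i - ?l + k)"
      by simp
    also have "\<dots> = ?l - k"
      using left_len_le[OF i1(1), of \<sigma>] by linarith
    finally show ?thesis
      using False by simp
  qed
  moreover have "card (L \<union> R) = card L + card R"
    by (rule card_Un_disjoint) (auto simp: L_def R_def)
  ultimately show ?thesis
    unfolding split naples_len_def by (simp add: R)
qed

section \<open>The fiber as a product of independent choices\<close>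

theorem theorem3p12:
  fixes n k :: nat and \<sigma> :: "nat \<Rightarrow> nat"
  assumes "n \<ge> 1" and "0 \<le> k" and "k \<le> n - 1" and "\<sigma> permutes {1..n}"
  shows "card {\<alpha> \<in> naples_parking_functions n k. outcome n k \<alpha> = \<sigma>}
           = (\<Prod>i = 1..n. naples_len n k \<sigma> i)"
proof -
  note \<sigma> = assms(4)
  let ?B = "\<lambda>i. {t \<in> {1..n}. \<sigma> t < \<sigma> i}"
  define S where "S i = {a \<in> {1..n}. naples_spot n k (?B i) a = Some i}" for i
  have inv: "inv \<sigma> (\<sigma> i) = i" for i
    using permutes_inverses(2)[OF \<sigma>] .
  \<comment> \<open>Preferences are indexed by cars but the sets \<open>S\<close> by spots; \<sigma>
    translates between the two.\<close>
  have all: "(\<forall>c\<in>{1..n}. P c) \<longleftrightarrow> (\<forall>i\<in>{1..n}. P (\<sigma> i))" for P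
    using permutes_image[OF \<sigma>] by (metis (no_types, lifting) image_iff)
  have "{\<alpha> \<in> naples_parking_functions n k. outcome n k \<alpha> = \<sigma>} =
      (\<Pi>\<^sub>E c\<in>{1..n}. S (inv \<sigma> c))" (is "?F = ?P")
  proof (rule set_eqI)
    fix \<alpha>
    have "\<alpha> \<in> ?F \<longleftrightarrow> \<alpha> \<in> {1..n} \<rightarrow>\<^sub>E {1..n} \<and>
        (\<alpha> \<in> naples_parking_functions n k \<and> outcome n k \<alpha> = \<sigma>)"
      by (auto simp: naples_parking_functions_def)
    also have "\<dots> \<longleftrightarrow> \<alpha> \<in> {1..n} \<rightarrow>\<^sub>E {1..n} \<and>
        (\<forall>i\<in>{1..n}. naples_spot n k (?B i) (\<alpha> (\<sigma> i)) = Some i)"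
      using parking_outcome_iff[OF _ \<sigma>] by blast
    \<comment> \<open>The range condition on \<alpha> is absorbed, because each \<open>S i\<close>
      lies in \<open>{1..n}\<close>.\<close>
    also have "\<dots> \<longleftrightarrow> \<alpha> \<in> extensional {1..n} \<and> (\<forall>i\<in>{1..n}. \<alpha> (\<sigma> i) \<in> S i)"
      unfolding PiE_def Pi_iff Int_iff all[of "\<lambda>c. \<alpha> c \<in> {1..n}"] S_def by auto
    also have "\<dots> \<longleftrightarrow> \<alpha> \<in> ?P"
      unfolding PiE_def Pi_iff Int_iff all[of "\<lambda>c. \<alpha> c \<in> S (inv \<sigma> c)"] inv by auto
    finally show "\<alpha> \<in> ?F \<longleftrightarrow> \<alpha> \<in> ?P" .
  qed
  then have "card ?F = (\<Prod>c\<in>{1..n}. card (S (inv \<sigma> c)))"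
    by (simp add: card_PiE)
  \<comment> \<open>Reindexing along \<open>inv \<sigma>\<close> turns the product over cars into
    one over spots.\<close>
  also have "\<dots> = (\<Prod>i\<in>{1..n}. card (S i))"
    using prod.permute[OF permutes_inv[OF \<sigma>], of "\<lambda>i. card (S i)"] by (simp add: o_def)
  also have "\<dots> = (\<Prod>i = 1..n. naples_len n k \<sigma> i)"
    unfolding S_def by (intro prod.cong refl card_preferences_for_spot permutes_inj[OF \<sigma>])
  finally show ?thesis .
qed

end
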